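(* Let $\mathcal J=(M,\lambda,\tau)$ be a weakly noetherian reduction structure, let $\mathcal J'=(M,\lambda,\tau')$ be a noetherian substructure of $\mathcal J$, and let $\overline\tau=\{\overline\tau_\alpha\}_{x^\alpha\in M}$ be a family of sets of terms with $\overline\tau_\alpha\subseteq\tau'_\alpha$ such that the sets $x^\alpha\overline\tau_\alpha$ ($x^\alpha\in M$) are pairwise disjoint with union $J$. Let $\mathcal F$ be a marked set over $\mathcal J$. If $\mathcal F$ is a marked basis, then $\rightarrow^+_{\mathcal F\mathcal J}$ is confluent. On the other hand, if $\rightarrow^+_{\mathcal F\mathcal J}$ is confluent, then the following conditions are equivalent to one another, and $\mathcal F$ is a marked basis if and only if one of them holds: (i) $(\mathcal F)=\langle\overline\tau\mathcal F\rangle$; (ii) $(\mathcal F)=\langle\tau'\mathcal F\rangle$; (iii) $(\mathcal F)=\langle\tau\mathcal F\rangle$; (iv) for each $x^\alpha\in M$ and each $x^\gamma\notin\overline\tau_\alpha$ it holds $x^\gamma f_\alpha\rightarrow^+_{\overline\tau\mathcal F\mathcal J}0\downarrow$; (v) for each $x^\alpha\in M$ and each $x^\gamma\notin\tau'_\alpha$ it holds $x^\gamma f_\alpha\rightarrow^+_{\mathcal F\mathcal J'}0\downarrow$; (vi) for each $x^\alpha\in M$ and each $x^\gamma\notin\tau_\alpha$ it holds $x^\gamma f_\alpha\rightarrow^+_{\mathcal F\mathcal J}0\downarrow$.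
   Context: Let $A$ be a field, $\mathcal P=A[x_1,\dots,x_n]$, and $\mathcal T$ the set of terms $x^\alpha=x_1^{\alpha_1}\cdots x_n^{\alpha_n}$, $\alpha\in\mathbb N^n$. $\operatorname{Supp}(g)\subset\mathcal T$ is the set of terms with nonzero coefficient in $g$; $\langle V\rangle$ is the $A$-span of $V\subset\mathcal P$ and $(V)$ the ideal of $\mathcal P$ generated by $V$. A semigroup ideal is a subset of $\mathcal T$ closed under multiplication by terms; an order ideal is the complement in $\mathcal T$ of a semigroup ideal. A reduction structure (RS) is a triple $\mathcal J=(M,\lambda=\{\lambda_\alpha\}_{x^\alpha\in M},\tau=\{\tau_\alpha\}_{x^\alpha\in M})$ where $M\subset\mathcal T$ is finite, $J$ denotes the semigroup ideal generated by $M$, each $\tau_\alpha\subseteq\mathcal T$ is an order ideal, $\operatorname{cone}(x^\alpha)=\{x^{\alpha+\eta}: x^\eta\in\tau_\alpha\}$, $\bigcup_{x^\alpha\in M}\operatorname{cone}(x^\alpha)=J$, and $\lambda_\alpha\subseteq\mathcal T\setminus\operatorname{cone}(x^\alpha)$. $\mathsf N(J)=\mathcal T\setminus J$. All RSs are assumed to have finite tails: every $\lambda_\alpha$ is finite. A substructure of $\mathcal J$ is an RS $(M,\lambda,\tau')$ with $\tau'_\alpha\subseteq\tau_\alpha$ for all $x^\alpha\in M$. A marked set over $\mathcal J$ is a set $\mathcal F=\{f_\alpha\}_{x^\alpha\in M}\subset\mathcal P$ such that $x^\alpha$ has coefficient $1$ in $f_\alpha$ and $\operatorname{Supp}(f_\alpha-x^\alpha)\subset\lambda_\alpha$.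 It is a marked basis if $(\mathcal F)\oplus\langle\mathsf N(J)\rangle=\mathcal P$. For a family $\sigma=\{\sigma_\alpha\}_{x^\alpha\in M}$ of subsets of $\mathcal T$ put $\sigma\mathcal F=\{x^\eta f_\alpha: x^\alpha\in M,\ x^\eta\in\sigma_\alpha\}$ (used for $\tau,\tau',\overline\tau$). One-step reduction: $g\rightarrow_{\mathcal F\mathcal J}h$ if there are $x^\gamma\in\operatorname{Supp}(g)$ with coefficient $c$ in $g$, $x^\alpha\in M$ and $x^\eta\in\tau_\alpha$ with $x^\gamma=x^{\alpha+\eta}$ and $h=g-cx^\eta f_\alpha$. $\rightarrow^+_{\mathcal F\mathcal J}$ is the reflexive-transitive closure. $\rightarrow^+_{\mathcal F\mathcal J'}$ is defined in the same way with $\tau'$ in place of $\tau$, and $\rightarrow^+_{\overline\tau\mathcal F\mathcal J}$ with $\overline\tau$ in place of $\tau$. For any of these relations, $g\rightarrow^+l\downarrow$ means $g\rightarrow^+l$ and $\operatorname{Supp}(l)\subset\mathsf N(J)$. An RS is noetherian if for every marked set over it there is no infinite chain of one-step reductions; it is weakly noetherian if it has a noetherian substructure. $\rightarrow^+_{\mathcal F\mathcal J}$ is confluent if for each $g\in\mathcal P$ there is one and only one $l$ with $g\rightarrow^+_{\mathcal F\mathcal J}l\downarrow$. *)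

theory Defs
  imports
    Complex_Main
    "HOL-Library.Poly_Mapping"
    "HOL-Library.Disjoint_Sets"
begin

text \<open>A term is represented by its exponent, so that multiplication of terms is addition of
  exponents. The nonempty finite type \<open>'n\<close> indexes the variables.\<close>

type_synonym 'n pterm = "'n \<Rightarrow>\<^sub>0 nat"
type_synonym ('n, 'a) mpol = "'n pterm \<Rightarrow>\<^sub>0 'a"

definition pmonom :: "'a \<Rightarrow> 'n pterm \<Rightarrow> ('n::finite, 'a::field) mpol" where
  "pmonom c \<alpha> = Poly_Mapping.single \<alpha> c"

definition pscale :: "'a \<Rightarrow> ('n::finite, 'a::field) mpol \<Rightarrow> ('n, 'a) mpol" where
  "pscale c p = pmonom c 0 * p"

interpretation lin: vector_space "pscale :: 'a::field \<Rightarrow> ('n::finite, 'a) mpol \<Rightarrow> ('n, 'a) mpol"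
  by unfold_locales
    (simp_all add: pscale_def pmonom_def distrib_left distrib_right single_add mult_single
      flip: mult.assoc)

interpretation idl: module "(*) :: ('n::finite, 'a::field) mpol \<Rightarrow> ('n, 'a) mpol \<Rightarrow> ('n, 'a) mpol"
  by unfold_locales (simp_all add: algebra_simps)

abbreviation lspan :: "('n::finite, 'a::field) mpol set \<Rightarrow> ('n, 'a) mpol set" where
  "lspan \<equiv> module.span pscale"

text \<open>An ideal is a submodule of the polynomial ring regarded as a module over itself.\<close>

abbreviation pideal :: "('n::finite, 'a::field) mpol set \<Rightarrow> ('n, 'a) mpol set" where
  "pideal \<equiv> module.span (*)"

definition semigroup_ideal :: "'n::finite pterm set \<Rightarrow> bool" where
  "semigroup_ideal S \<longleftrightarrow> (\<forall>\<alpha>\<in>S. \<forall>\<eta>. \<alpha> + \<eta> \<in> S)"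

definition order_ideal :: "'n::finite pterm set \<Rightarrow> bool" where
  "order_ideal S \<longleftrightarrow> (\<exists>I. semigroup_ideal I \<and> S = - I)"

definition sg_ideal :: "'n::finite pterm set \<Rightarrow> 'n pterm set" where
  "sg_ideal M = semigroup_ideal hull M"

definition nform_terms :: "'n::finite pterm set \<Rightarrow> 'n pterm set" where
  "nform_terms M = - sg_ideal M"

definition cone :: "('n::finite pterm \<Rightarrow> 'n pterm set) \<Rightarrow> 'n pterm \<Rightarrow> 'n pterm set" where
  "cone \<tau> \<alpha> = (\<lambda>\<eta>. \<alpha> + \<eta>) ` \<tau> \<alpha>"

text \<open>Families indexed by \<open>M\<close> are total functions whose values outside \<open>M\<close> are never used;
  the family of tails is written \<open>\<Lambda>\<close>.
  Finiteness of the tails is part of the definition of a reduction structure.\<close>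

definition reduction_structure ::
  "'n::finite pterm set \<Rightarrow> ('n pterm \<Rightarrow> 'n pterm set) \<Rightarrow> ('n pterm \<Rightarrow> 'n pterm set) \<Rightarrow> bool" where
  "reduction_structure M \<Lambda> \<tau> \<longleftrightarrow>
     finite M \<and>
     (\<forall>\<alpha>\<in>M. order_ideal (\<tau> \<alpha>)) \<and>
     (\<Union>\<alpha>\<in>M. cone \<tau> \<alpha>) = sg_ideal M \<and>
     (\<forall>\<alpha>\<in>M. finite (\<Lambda> \<alpha>) \<and> \<Lambda> \<alpha> \<subseteq> - cone \<tau> \<alpha>)"

definition substructure ::
  "'n::finite pterm set \<Rightarrow> ('n pterm \<Rightarrow> 'n pterm set) \<Rightarrow> ('n pterm \<Rightarrow> 'n pterm set) \<Rightarrow>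
   ('n pterm \<Rightarrow> 'n pterm set) \<Rightarrow> bool" where
  "substructure M \<Lambda> \<tau>' \<tau> \<longleftrightarrow> reduction_structure M \<Lambda> \<tau>' \<and> (\<forall>\<alpha>\<in>M. \<tau>' \<alpha> \<subseteq> \<tau> \<alpha>)"

definition marked_set ::
  "'n::finite pterm set \<Rightarrow> ('n pterm \<Rightarrow> 'n pterm set) \<Rightarrow> ('n pterm \<Rightarrow> ('n, 'a::field) mpol) \<Rightarrow> bool" where
  "marked_set M \<Lambda> f \<longleftrightarrow>
     (\<forall>\<alpha>\<in>M. Poly_Mapping.lookup (f \<alpha>) \<alpha> = 1 \<and> Poly_Mapping.keys (f \<alpha> - pmonom 1 \<alpha>) \<subseteq> \<Lambda> \<alpha>)"

definition marked_basis ::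
  "'n::finite pterm set \<Rightarrow> ('n pterm \<Rightarrow> 'n pterm set) \<Rightarrow> ('n pterm \<Rightarrow> ('n, 'a::field) mpol) \<Rightarrow> bool" where
  "marked_basis M \<Lambda> f \<longleftrightarrow>
     marked_set M \<Lambda> f \<and>
     pideal (f ` M) \<inter> lspan (pmonom 1 ` nform_terms M) = {0} \<and>
     {p + q | p q. p \<in> pideal (f ` M) \<and> q \<in> lspan (pmonom 1 ` nform_terms M)} = UNIV"

definition term_multiples ::
  "'n::finite pterm set \<Rightarrow> ('n pterm \<Rightarrow> 'n pterm set) \<Rightarrow> ('n pterm \<Rightarrow> ('n, 'a::field) mpol) \<Rightarrow>
   ('n, 'a) mpol set" where
  "term_multiples M \<sigma> f = {pmonom 1 \<eta> * f \<alpha> | \<alpha> \<eta>. \<alpha> \<in> M \<and> \<eta> \<in> \<sigma> \<alpha>}"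

definition red_step ::
  "'n::finite pterm set \<Rightarrow> ('n pterm \<Rightarrow> 'n pterm set) \<Rightarrow> ('n pterm \<Rightarrow> ('n, 'a::field) mpol) \<Rightarrow>
   ('n, 'a) mpol \<Rightarrow> ('n, 'a) mpol \<Rightarrow> bool" where
  "red_step M \<sigma> f g h \<longleftrightarrow>
     (\<exists>\<gamma>\<in>Poly_Mapping.keys g. \<exists>\<alpha>\<in>M. \<exists>\<eta>\<in>\<sigma> \<alpha>. \<gamma> = \<alpha> + \<eta> \<and> h = g - pmonom (Poly_Mapping.lookup g \<gamma>) \<eta> * f \<alpha>)"

definition reduces_to_nf ::
  "'n::finite pterm set \<Rightarrow> ('n pterm \<Rightarrow> 'n pterm set) \<Rightarrow> ('n pterm \<Rightarrow> ('n, 'a::field) mpol) \<Rightarrow>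
   ('n, 'a) mpol \<Rightarrow> ('n, 'a) mpol \<Rightarrow> bool" where
  "reduces_to_nf M \<sigma> f g l \<longleftrightarrow> (red_step M \<sigma> f)\<^sup>*\<^sup>* g l \<and> Poly_Mapping.keys l \<subseteq> nform_terms M"

text \<open>This is not confluence of an abstract rewriting relation: every polynomial is required to
  reduce to exactly one polynomial supported outside the semigroup ideal.\<close>

definition confluent_red ::
  "'n::finite pterm set \<Rightarrow> ('n pterm \<Rightarrow> 'n pterm set) \<Rightarrow> ('n pterm \<Rightarrow> ('n, 'a::field) mpol) \<Rightarrow> bool" where
  "confluent_red M \<sigma> f \<longleftrightarrow> (\<forall>g. \<exists>!l. reduces_to_nf M \<sigma> f g l)"

text \<open>Noetherianity quantifies over all marked sets over the structure, hence depends on the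
  coefficient field, which is passed as a type argument.\<close>

definition noetherian_rs ::
  "'a::field itself \<Rightarrow> 'n::finite pterm set \<Rightarrow> ('n pterm \<Rightarrow> 'n pterm set) \<Rightarrow>
   ('n pterm \<Rightarrow> 'n pterm set) \<Rightarrow> bool" where
  "noetherian_rs A M \<Lambda> \<tau> \<longleftrightarrow>
     reduction_structure M \<Lambda> \<tau> \<and>
     (\<forall>f :: 'n pterm \<Rightarrow> ('n, 'a) mpol. marked_set M \<Lambda> f \<longrightarrow>
        \<not> (\<exists>s :: nat \<Rightarrow> ('n, 'a) mpol. \<forall>i. red_step M \<tau> f (s i) (s (Suc i))))"

definition weakly_noetherian_rs ::
  "'a::field itself \<Rightarrow> 'n::finite pterm set \<Rightarrow> ('n pterm \<Rightarrow> 'n pterm set) \<Rightarrow>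
   ('n pterm \<Rightarrow> 'n pterm set) \<Rightarrow> bool" where
  "weakly_noetherian_rs A M \<Lambda> \<tau> \<longleftrightarrow>
     reduction_structure M \<Lambda> \<tau> \<and>
     (\<exists>\<tau>'. substructure M \<Lambda> \<tau>' \<tau> \<and> noetherian_rs A M \<Lambda> \<tau>')"

end

theory Submission
  imports Defs
begin

text \<open>Write \<open>N\<close> for the terms outside the semigroup ideal \<open>J\<close> and, for a family \<open>\<sigma>\<close>, write
  \<open>S \<sigma>\<close> for the linear span of the multiples \<open>x\<^sup>\<eta> f\<^sub>\<alpha>\<close> with \<open>\<eta>\<close> in \<open>\<sigma> \<alpha>\<close>. A reduction step
  subtracts an element of \<open>S \<sigma>\<close>, so a normal form of \<open>g\<close> is congruent to \<open>g\<close> modulo \<open>S \<sigma>\<close>.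
  Reduction by \<open>\<tau>bar\<close> terminates because it is contained in reduction by the noetherian \<open>\<tau>'\<close>,
  and it can only stop at polynomials supported in \<open>N\<close> because the cones of \<open>\<tau>bar\<close> cover \<open>J\<close>.
  Hence already \<open>S \<tau>bar + \<langle>N\<rangle>\<close> is the whole ring. In particular \<open>f\<close> is a marked basis exactly
  when its ideal meets \<open>\<langle>N\<rangle>\<close> in zero only, and then two normal forms of one polynomial, which
  differ by an element of the ideal, coincide: reduction by \<open>\<tau>\<close> is confluent.

  Reduction by \<open>\<tau>\<close> need not terminate, yet confluence still forces \<open>S \<tau>\<close> to meet \<open>\<langle>N\<rangle>\<close> in zero
  only (\<open>span_multiples_inter_normal_forms\<close>). The point is that \<open>y\<close> and \<open>y + c x\<^sup>\<eta> f\<^sub>\<alpha>\<close> have a common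
  reduct, in which the coefficient of \<open>x\<^sup>\<alpha>\<^sup>+\<^sup>\<eta>\<close> has been cleared; so all elements of \<open>S \<tau>\<close>
  reduce to zero, while an element of \<open>\<langle>N\<rangle>\<close> is its own normal form.

  Thus, under confluence, \<open>S \<tau>bar \<subseteq> S \<tau>' \<subseteq> S \<tau>\<close> are all complements of \<open>\<langle>N\<rangle>\<close>, so they are
  equal, and each of the conditions (i) to (iii) says that this complement is the ideal. Each of
  (iv) to (vi) is equivalent to the one of (i) to (iii) for the same family: the ideal is spanned by
  all multiples \<open>x\<^sup>\<gamma> f\<^sub>\<alpha>\<close>, and such a multiple lies in \<open>S \<sigma>\<close> precisely when its normal form,
  an element of \<open>\<langle>N\<rangle>\<close>, is zero (\<open>ideal_eq_span_iff_multiples_reduce_to_zero\<close>).\<close>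

section \<open>Spans of monomials and of multiples\<close>

lemma lookup_pmonom_mult:
  fixes p :: "('n::finite, 'a::field) mpol"
  shows "Poly_Mapping.lookup (pmonom c \<eta> * p) (\<alpha> + \<eta>) = c * Poly_Mapping.lookup p \<alpha>"
proof -
  have "Poly_Mapping.lookup (pmonom c \<eta> * p) (\<alpha> + \<eta>)
      = c * (\<Sum>q. Poly_Mapping.lookup p q when \<alpha> + \<eta> = \<eta> + q)"
    by (simp only: lookup_mult pmonom_def lookup_single when_mult Sum_any_when_equal')
  then show ?thesis by (simp add: add.commute[of \<alpha>])
qed

lemma sum_pmonom_keys:
  fixes p :: "('n::finite, 'a::field) mpol"
  shows "(\<Sum>k\<in>Poly_Mapping.keys p. pmonom (Poly_Mapping.lookup p k) k) = p"
  by (rule poly_mapping_eqI)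
    (simp add: pmonom_def lookup_sum lookup_single when_def in_keys_iff)

lemma pscale_pmonom_mult: "pscale c (pmonom d \<eta> * p) = pmonom (c * d) \<eta> * p"
  by (simp add: pscale_def pmonom_def mult_single flip: mult.assoc)

lemma lspan_pmonom:
  "lspan (pmonom 1 ` S) = {p :: ('n::finite, 'a::field) mpol. Poly_Mapping.keys p \<subseteq> S}"
proof
  show "lspan (pmonom 1 ` S) \<subseteq> {p :: ('n, 'a) mpol. Poly_Mapping.keys p \<subseteq> S}"
  proof
    fix p :: "('n, 'a) mpol"
    assume "p \<in> lspan (pmonom 1 ` S)"
    then have "Poly_Mapping.keys p \<subseteq> S"
    proof (induction rule: lin.span_induct_alt)
      case base
      then show ?case by simp
    next
      case (step c x y)
      then obtain \<eta> where "\<eta> \<in> S" "x = pmonom 1 \<eta>" by blast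
      then have "Poly_Mapping.keys (pscale c x) \<subseteq> S"
        by (simp add: pscale_def pmonom_def mult_single)
      with step show ?case
        using Poly_Mapping.keys_add[of "pscale c x" y] by blast
    qed
    then show "p \<in> {p. Poly_Mapping.keys p \<subseteq> S}" by simp
  qed
next
  show "{p :: ('n, 'a) mpol. Poly_Mapping.keys p \<subseteq> S} \<subseteq> lspan (pmonom 1 ` S)"
  proof clarify
    fix p :: "('n, 'a) mpol"
    assume S: "Poly_Mapping.keys p \<subseteq> S"
    have "p = (\<Sum>k\<in>Poly_Mapping.keys p. pscale (Poly_Mapping.lookup p k) (pmonom 1 k))"
      by (subst sum_pmonom_keys[symmetric]) (simp add: pscale_def pmonom_def mult_single)
    also have "\<dots> \<in> lspan (pmonom 1 ` S)"
      using S by (intro lin.span_sum lin.span_scale lin.span_base) auto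
    finally show "p \<in> lspan (pmonom 1 ` S)" .
  qed
qed

lemma pmonom_mult_in_span_multiples:
  fixes f :: "'n::finite pterm \<Rightarrow> ('n, 'a::field) mpol"
  assumes "\<alpha> \<in> M" and "\<eta> \<in> \<sigma> \<alpha>"
  shows "pmonom c \<eta> * f \<alpha> \<in> lspan (term_multiples M \<sigma> f)"
proof -
  have "pmonom 1 \<eta> * f \<alpha> \<in> lspan (term_multiples M \<sigma> f)"
    using assms by (intro lin.span_base) (auto simp: term_multiples_def)
  from lin.span_scale[OF this, of c] show ?thesis
    by (simp add: pscale_pmonom_mult)
qed

lemma span_multiples_mono:
  fixes f :: "'n::finite pterm \<Rightarrow> ('n, 'a::field) mpol"
  assumes "\<And>\<alpha>. \<alpha> \<in> M \<Longrightarrow> \<sigma> \<alpha> \<subseteq> \<sigma>' \<alpha>"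
  shows "lspan (term_multiples M \<sigma> f) \<subseteq> lspan (term_multiples M \<sigma>' f)"
  using assms unfolding term_multiples_def by (intro lin.span_mono) blast

text \<open>Multiplying a generator by a polynomial is a linear combination of multiplications by terms.\<close>

lemma ideal_eq_span_all_multiples:
  fixes f :: "'n::finite pterm \<Rightarrow> ('n, 'a::field) mpol"
  shows "pideal (f ` M) = lspan (term_multiples M (\<lambda>_. UNIV) f)"
proof
  show "pideal (f ` M) \<subseteq> lspan (term_multiples M (\<lambda>_. UNIV) f)"
  proof
    fix p
    assume "p \<in> pideal (f ` M)"
    then show "p \<in> lspan (term_multiples M (\<lambda>_. UNIV) f)"
    proof (induction rule: idl.span_induct_alt)
      case base
      then show ?case by (rule lin.span_zero)
    next
      case (step q x y)
      then obtain \<alpha> where \<alpha>: "\<alpha> \<in> M" "x = f \<alpha>" by blast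
      have "q * x = (\<Sum>k\<in>Poly_Mapping.keys q. pmonom (Poly_Mapping.lookup q k) k) * f \<alpha>"
        using \<alpha> by (simp add: sum_pmonom_keys)
      also have "\<dots> \<in> lspan (term_multiples M (\<lambda>_. UNIV) f)"
        unfolding sum_distrib_right using \<alpha>
        by (intro lin.span_sum pmonom_mult_in_span_multiples) auto
      finally show ?case using step by (intro lin.span_add)
    qed
  qed
next
  show "lspan (term_multiples M (\<lambda>_. UNIV) f) \<subseteq> pideal (f ` M)"
  proof
    fix p
    assume "p \<in> lspan (term_multiples M (\<lambda>_. UNIV) f)"
    then show "p \<in> pideal (f ` M)"
    proof (induction rule: lin.span_induct_alt)
      case base
      then show ?case by (rule idl.span_zero)
    next
      case (step c x y)
      then obtain \<alpha> \<eta> where "\<alpha> \<in> M" "x = pmonom 1 \<eta> * f \<alpha>"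
        by (auto simp: term_multiples_def)
      then have "pscale c x \<in> pideal (f ` M)"
        by (simp add: pscale_pmonom_mult idl.span_scale idl.span_base)
      with step show ?case by (intro idl.span_add)
    qed
  qed
qed

corollary span_multiples_subset_ideal:
  fixes f :: "'n::finite pterm \<Rightarrow> ('n, 'a::field) mpol"
  shows "lspan (term_multiples M \<sigma> f) \<subseteq> pideal (f ` M)"
  unfolding ideal_eq_span_all_multiples by (rule span_multiples_mono) simp

section \<open>Reduction and normal forms\<close>

lemma red_step_mono:
  assumes "red_step M \<sigma> f g h" and "\<And>\<alpha>. \<alpha> \<in> M \<Longrightarrow> \<sigma> \<alpha> \<subseteq> \<sigma>' \<alpha>"
  shows "red_step M \<sigma>' f g h"
  using assms unfolding red_step_def by blast

lemma reduces_to_nf_mono: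
  assumes "reduces_to_nf M \<sigma> f g l" and "\<And>\<alpha>. \<alpha> \<in> M \<Longrightarrow> \<sigma> \<alpha> \<subseteq> \<sigma>' \<alpha>"
  shows "reduces_to_nf M \<sigma>' f g l"
proof -
  have "red_step M \<sigma> f \<le> red_step M \<sigma>' f"
    using assms(2) by (auto intro: red_step_mono)
  from rtranclp_mono[OF this] assms(1) show ?thesis
    unfolding reduces_to_nf_def by blast
qed

lemma reduces_to_nf_refl: "Poly_Mapping.keys l \<subseteq> nform_terms M \<Longrightarrow> reduces_to_nf M \<sigma> f l l"
  by (simp add: reduces_to_nf_def)

lemma reduces_to_nf_diff_in_span:
  fixes f :: "'n::finite pterm \<Rightarrow> ('n, 'a::field) mpol"
  assumes "reduces_to_nf M \<sigma> f g l"
  shows "g - l \<in> lspan (term_multiples M \<sigma> f)"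
proof -
  have "(red_step M \<sigma> f)\<^sup>*\<^sup>* g l" using assms by (simp add: reduces_to_nf_def)
  then show ?thesis
  proof (induction rule: rtranclp_induct)
    case base
    then show ?case by (simp add: lin.span_zero)
  next
    case (step h k)
    then have "h - k \<in> lspan (term_multiples M \<sigma> f)"
      by (auto simp: red_step_def intro: pmonom_mult_in_span_multiples)
    from lin.span_add[OF step.IH this] show ?case by simp
  qed
qed

text \<open>A polynomial with a term in \<open>J\<close> admits a further step because the cones cover \<open>J\<close>, so a
  terminating reduction cannot stop before reaching a normal form.\<close>

lemma terminating_reduction_has_normal_form:
  fixes f :: "'n::finite pterm \<Rightarrow> ('n, 'a::field) mpol"
  assumes terminating: "\<not> (\<exists>s :: nat \<Rightarrow> ('n, 'a) mpol. \<forall>i. red_step M \<sigma> f (s i) (s (Suc i)))"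
    and cover: "(\<Union>\<alpha>\<in>M. cone \<sigma> \<alpha>) = sg_ideal M"
  shows "\<exists>l. reduces_to_nf M \<sigma> f g l"
proof -
  have "wfp (\<lambda>h g. red_step M \<sigma> f g h)"
    using terminating by (simp add: wfp_def wf_iff_no_infinite_down_chain)
  then show ?thesis
  proof (induction g rule: wfp_induct_rule)
    case (less g)
    show ?case
    proof (cases "Poly_Mapping.keys g \<subseteq> nform_terms M")
      case True
      then show ?thesis by (blast intro: reduces_to_nf_refl)
    next
      case False
      then obtain \<alpha> \<eta> where "\<alpha> \<in> M" "\<eta> \<in> \<sigma> \<alpha>" "\<alpha> + \<eta> \<in> Poly_Mapping.keys g"
        unfolding nform_terms_def cover[symmetric] cone_def by blast
      then have step: "red_step M \<sigma> f g (g - pmonom (Poly_Mapping.lookup g (\<alpha> + \<eta>)) \<eta> * f \<alpha>)"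
        unfolding red_step_def by blast
      with less obtain l where
        "reduces_to_nf M \<sigma> f (g - pmonom (Poly_Mapping.lookup g (\<alpha> + \<eta>)) \<eta> * f \<alpha>) l" by blast
      with step show ?thesis
        by (auto simp: reduces_to_nf_def intro: converse_rtranclp_into_rtranclp)
    qed
  qed
qed

text \<open>Clearing one coefficient takes one step, or none if that coefficient already vanishes.\<close>

lemma clear_coefficient:
  assumes "\<alpha> \<in> M" and "\<eta> \<in> \<sigma> \<alpha>"
  shows "(red_step M \<sigma> f)\<^sup>*\<^sup>* g (g - pmonom (Poly_Mapping.lookup g (\<alpha> + \<eta>)) \<eta> * f \<alpha>)"
proof (cases "\<alpha> + \<eta> \<in> Poly_Mapping.keys g")
  case True
  with assms have "red_step M \<sigma> f g (g - pmonom (Poly_Mapping.lookup g (\<alpha> + \<eta>)) \<eta> * f \<alpha>)"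
    unfolding red_step_def by blast
  then show ?thesis by blast
next
  case False
  then show ?thesis by (simp add: in_keys_iff pmonom_def)
qed

text \<open>Adding \<open>c x\<^sup>\<eta> f\<^sub>\<alpha>\<close> changes the coefficient of \<open>x\<^sup>\<alpha>\<^sup>+\<^sup>\<eta>\<close> by \<open>c\<close>, since the marked coefficient
  of \<open>f\<^sub>\<alpha>\<close> is one; hence clearing this coefficient before or after the addition gives the
  same polynomial, and uniqueness of normal forms transports a normal form along it.\<close>

lemma confluent_span_multiples_reduce_to_zero:
  fixes f :: "'n::finite pterm \<Rightarrow> ('n, 'a::field) mpol"
  assumes confluent: "confluent_red M \<sigma> f"
    and monic: "\<And>\<alpha>. \<alpha> \<in> M \<Longrightarrow> Poly_Mapping.lookup (f \<alpha>) \<alpha> = 1"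
    and "p \<in> lspan (term_multiples M \<sigma> f)"
  shows "reduces_to_nf M \<sigma> f p 0"
  using assms(3)
proof (induction rule: lin.span_induct_alt)
  case base
  then show ?case by (simp add: reduces_to_nf_refl)
next
  case (step c x y)
  then obtain \<alpha> \<eta> where mem: "\<alpha> \<in> M" "\<eta> \<in> \<sigma> \<alpha>" and x: "x = pmonom 1 \<eta> * f \<alpha>"
    by (auto simp: term_multiples_def)
  define h where "h = y - pmonom (Poly_Mapping.lookup y (\<alpha> + \<eta>)) \<eta> * f \<alpha>"
  let ?g = "pscale c x + y"
  have "?g - pmonom (Poly_Mapping.lookup ?g (\<alpha> + \<eta>)) \<eta> * f \<alpha> = h"
    using monic[OF mem(1)]
    by (simp add: h_def x pscale_pmonom_mult lookup_add lookup_pmonom_mult)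
      (simp add: pmonom_def single_add algebra_simps)
  then have g_h: "(red_step M \<sigma> f)\<^sup>*\<^sup>* ?g h"
    using clear_coefficient[of \<alpha> M \<eta> \<sigma> f ?g] mem by simp
  have y_h: "(red_step M \<sigma> f)\<^sup>*\<^sup>* y h"
    using clear_coefficient[of \<alpha> M \<eta> \<sigma> f y] mem by (simp add: h_def)
  obtain l where l: "reduces_to_nf M \<sigma> f h l"
    using confluent unfolding confluent_red_def by blast
  with y_h have "reduces_to_nf M \<sigma> f y l"
    by (auto simp: reduces_to_nf_def)
  with step.IH have "l = 0"
    using confluent unfolding confluent_red_def by blast
  with g_h l show ?case
    by (auto simp: reduces_to_nf_def)
qed

corollary span_multiples_inter_normal_forms:
  fixes f :: "'n::finite pterm \<Rightarrow> ('n, 'a::field) mpol"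
  assumes confluent: "confluent_red M \<sigma> f"
    and "\<And>\<alpha>. \<alpha> \<in> M \<Longrightarrow> Poly_Mapping.lookup (f \<alpha>) \<alpha> = 1"
    and "p \<in> lspan (term_multiples M \<sigma> f)"
    and "Poly_Mapping.keys p \<subseteq> nform_terms M"
  shows "p = 0"
  using confluent_span_multiples_reduce_to_zero[OF assms(1-3)] reduces_to_nf_refl[OF assms(4)]
    confluent unfolding confluent_red_def by blast

section \<open>Complements of the space of normal forms\<close>

text \<open>Existence of normal forms gives the sum decomposition, which leaves directness to check.\<close>

lemma marked_basis_iff_ideal_inter_normal_forms:
  fixes f :: "'n::finite pterm \<Rightarrow> ('n, 'a::field) mpol"
  assumes marked: "marked_set M \<Lambda> f"
    and nf: "\<And>g. \<exists>l. reduces_to_nf M \<sigma> f g l"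
  shows "marked_basis M \<Lambda> f \<longleftrightarrow>
    (\<forall>p\<in>pideal (f ` M). Poly_Mapping.keys p \<subseteq> nform_terms M \<longrightarrow> p = 0)"
proof -
  have "g \<in> {p + q | p q. p \<in> pideal (f ` M) \<and> Poly_Mapping.keys q \<subseteq> nform_terms M}" for g
  proof -
    obtain l where l: "reduces_to_nf M \<sigma> f g l" using nf by blast
    then have "g - l \<in> pideal (f ` M)"
      using reduces_to_nf_diff_in_span span_multiples_subset_ideal by blast
    moreover have "Poly_Mapping.keys l \<subseteq> nform_terms M"
      using l by (simp add: reduces_to_nf_def)
    moreover have "g = (g - l) + l" by simp
    ultimately show ?thesis by blast
  qed
  moreover have "0 \<in> pideal (f ` M)" by (rule idl.span_zero)
  ultimately show ?thesis
    using marked by (auto simp: marked_basis_def lspan_pmonom)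
qed

lemma marked_basis_unique_normal_form:
  fixes f :: "'n::finite pterm \<Rightarrow> ('n, 'a::field) mpol"
  assumes basis: "marked_basis M \<Lambda> f"
    and l: "reduces_to_nf M \<sigma> f g l" and l': "reduces_to_nf M \<sigma> f g l'"
  shows "l = l'"
proof -
  have "(g - l') - (g - l) \<in> pideal (f ` M)"
    using l l' reduces_to_nf_diff_in_span span_multiples_subset_ideal by (blast intro: idl.span_diff)
  then have "l - l' \<in> pideal (f ` M)" by simp
  moreover have "Poly_Mapping.keys (l - l') \<subseteq> nform_terms M"
    using l l' keys_diff[of l l'] by (auto simp: reduces_to_nf_def)
  ultimately have "l - l' = 0"
    using basis unfolding marked_basis_def lspan_pmonom by blast
  then show ?thesis by simp
qed

text \<open>Two nested subspaces agree if the smaller one together with \<open>\<langle>N\<rangle>\<close> spans everything and the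
  larger one meets \<open>\<langle>N\<rangle>\<close> in zero only.\<close>

lemma span_multiples_eqI:
  fixes f :: "'n::finite pterm \<Rightarrow> ('n, 'a::field) mpol"
  assumes nf: "\<And>g. \<exists>l. reduces_to_nf M \<sigma> f g l"
    and sub: "\<And>\<alpha>. \<alpha> \<in> M \<Longrightarrow> \<sigma> \<alpha> \<subseteq> \<sigma>' \<alpha>"
    and direct: "\<And>p. p \<in> lspan (term_multiples M \<sigma>' f) \<Longrightarrow>
      Poly_Mapping.keys p \<subseteq> nform_terms M \<Longrightarrow> p = 0"
  shows "lspan (term_multiples M \<sigma> f) = lspan (term_multiples M \<sigma>' f)"
proof
  show le: "lspan (term_multiples M \<sigma> f) \<subseteq> lspan (term_multiples M \<sigma>' f)"
    using sub by (rule span_multiples_mono)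
  show "lspan (term_multiples M \<sigma>' f) \<subseteq> lspan (term_multiples M \<sigma> f)"
  proof
    fix p
    assume p: "p \<in> lspan (term_multiples M \<sigma>' f)"
    obtain l where l: "reduces_to_nf M \<sigma> f p l" using nf by blast
    then have diff: "p - l \<in> lspan (term_multiples M \<sigma> f)"
      by (rule reduces_to_nf_diff_in_span)
    with le have "p - (p - l) \<in> lspan (term_multiples M \<sigma>' f)"
      using p by (blast intro: lin.span_diff)
    then have "l = 0" using l direct by (simp add: reduces_to_nf_def)
    with diff show "p \<in> lspan (term_multiples M \<sigma> f)" by simp
  qed
qed

text \<open>Only multiples \<open>x\<^sup>\<gamma> f\<^sub>\<alpha>\<close> with \<open>\<gamma>\<close> outside \<open>\<sigma> \<alpha>\<close> have to be tested, since the others belong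
  to the spanning set.\<close>

lemma ideal_eq_span_iff_multiples_reduce_to_zero:
  fixes f :: "'n::finite pterm \<Rightarrow> ('n, 'a::field) mpol"
  assumes nf: "\<And>g. \<exists>l. reduces_to_nf M \<sigma> f g l"
    and direct: "\<And>p. p \<in> lspan (term_multiples M \<sigma> f) \<Longrightarrow>
      Poly_Mapping.keys p \<subseteq> nform_terms M \<Longrightarrow> p = 0"
  shows "pideal (f ` M) = lspan (term_multiples M \<sigma> f) \<longleftrightarrow>
    (\<forall>\<alpha>\<in>M. \<forall>\<gamma>. \<gamma> \<notin> \<sigma> \<alpha> \<longrightarrow> reduces_to_nf M \<sigma> f (pmonom 1 \<gamma> * f \<alpha>) 0)"
proof
  assume eq: "pideal (f ` M) = lspan (term_multiples M \<sigma> f)"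
  show "\<forall>\<alpha>\<in>M. \<forall>\<gamma>. \<gamma> \<notin> \<sigma> \<alpha> \<longrightarrow> reduces_to_nf M \<sigma> f (pmonom 1 \<gamma> * f \<alpha>) 0"
  proof (intro ballI allI impI)
    fix \<alpha> \<gamma>
    assume "\<alpha> \<in> M"
    let ?p = "pmonom 1 \<gamma> * f \<alpha>"
    obtain l where l: "reduces_to_nf M \<sigma> f ?p l" using nf by blast
    have "?p \<in> pideal (f ` M)"
      using \<open>\<alpha> \<in> M\<close> by (intro idl.span_scale idl.span_base) simp
    then have "?p - (?p - l) \<in> lspan (term_multiples M \<sigma> f)"
      unfolding eq using reduces_to_nf_diff_in_span[OF l] by (rule lin.span_diff)
    then have "l = 0" using l direct by (simp add: reduces_to_nf_def)
    with l show "reduces_to_nf M \<sigma> f ?p 0" by simp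
  qed
next
  assume zero: "\<forall>\<alpha>\<in>M. \<forall>\<gamma>. \<gamma> \<notin> \<sigma> \<alpha> \<longrightarrow> reduces_to_nf M \<sigma> f (pmonom 1 \<gamma> * f \<alpha>) 0"
  have "pmonom 1 \<gamma> * f \<alpha> \<in> lspan (term_multiples M \<sigma> f)" if "\<alpha> \<in> M" for \<alpha> \<gamma>
    using that zero reduces_to_nf_diff_in_span[of M \<sigma> f "pmonom 1 \<gamma> * f \<alpha>" 0]
      pmonom_mult_in_span_multiples[of \<alpha> M \<gamma> \<sigma> 1 f]
    by (cases "\<gamma> \<in> \<sigma> \<alpha>") auto
  then have "term_multiples M (\<lambda>_. UNIV) f \<subseteq> lspan (term_multiples M \<sigma> f)"
    by (auto simp: term_multiples_def[of M "\<lambda>_. UNIV"])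
  then have "pideal (f ` M) \<subseteq> lspan (term_multiples M \<sigma> f)"
    unfolding ideal_eq_span_all_multiples
    by (rule lin.span_minimal) (rule lin.subspace_span)
  then show "pideal (f ` M) = lspan (term_multiples M \<sigma> f)"
    using span_multiples_subset_ideal by blast
qed

section \<open>Marked bases and confluence\<close>

theorem theorem7p7:
  fixes M :: "'n::finite pterm set"
    and \<Lambda> \<tau> \<tau>' \<tau>bar :: "'n pterm \<Rightarrow> 'n pterm set"
    and f :: "'n pterm \<Rightarrow> ('n, 'a::field) mpol"
  assumes "weakly_noetherian_rs TYPE('a) M \<Lambda> \<tau>"
    and "substructure M \<Lambda> \<tau>' \<tau>"
    and "noetherian_rs TYPE('a) M \<Lambda> \<tau>'"
    and "\<And>\<alpha>. \<alpha> \<in> M \<Longrightarrow> \<tau>bar \<alpha> \<subseteq> \<tau>' \<alpha>"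
    and "disjoint_family_on (cone \<tau>bar) M"
    and "(\<Union>\<alpha>\<in>M. cone \<tau>bar \<alpha>) = sg_ideal M"
    and "marked_set M \<Lambda> f"
  shows "(marked_basis M \<Lambda> f \<longrightarrow> confluent_red M \<tau> f) \<and>
    (confluent_red M \<tau> f \<longrightarrow>
      (let
         c1 = (pideal (f ` M) = lspan (term_multiples M \<tau>bar f));
         c2 = (pideal (f ` M) = lspan (term_multiples M \<tau>' f));
         c3 = (pideal (f ` M) = lspan (term_multiples M \<tau> f));
         c4 = (\<forall>\<alpha>\<in>M. \<forall>\<gamma>. \<gamma> \<notin> \<tau>bar \<alpha> \<longrightarrow> reduces_to_nf M \<tau>bar f (pmonom 1 \<gamma> * f \<alpha>) 0);
         c5 = (\<forall>\<alpha>\<in>M. \<forall>\<gamma>. \<gamma> \<notin> \<tau>' \<alpha> \<longrightarrow> reduces_to_nf M \<tau>' f (pmonom 1 \<gamma> * f \<alpha>) 0);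
         c6 = (\<forall>\<alpha>\<in>M. \<forall>\<gamma>. \<gamma> \<notin> \<tau> \<alpha> \<longrightarrow> reduces_to_nf M \<tau> f (pmonom 1 \<gamma> * f \<alpha>) 0)
       in
       (c1 \<longleftrightarrow> c2) \<and> (c2 \<longleftrightarrow> c3) \<and> (c3 \<longleftrightarrow> c4) \<and> (c4 \<longleftrightarrow> c5) \<and> (c5 \<longleftrightarrow> c6) \<and>
       (marked_basis M \<Lambda> f \<longleftrightarrow> c1 \<or> c2 \<or> c3 \<or> c4 \<or> c5 \<or> c6)))"
proof -
  have sub: "\<tau>' \<alpha> \<subseteq> \<tau> \<alpha>" if "\<alpha> \<in> M" for \<alpha>
    using assms(2) that by (simp add: substructure_def)
  have sub_bar: "\<tau>bar \<alpha> \<subseteq> \<tau> \<alpha>" if "\<alpha> \<in> M" for \<alpha>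
    using sub assms(4) that by blast
  have monic: "Poly_Mapping.lookup (f \<alpha>) \<alpha> = 1" if "\<alpha> \<in> M" for \<alpha>
    using assms(7) that by (simp add: marked_set_def)
  have "\<not> (\<exists>s. \<forall>i. red_step M \<tau>' f (s i) (s (Suc i)))"
    using assms(3,7) by (simp add: noetherian_rs_def)
  then have "\<not> (\<exists>s. \<forall>i. red_step M \<tau>bar f (s i) (s (Suc i)))"
    using red_step_mono[of M \<tau>bar f _ _ \<tau>'] assms(4) by meson
  then have nf_bar: "\<exists>l. reduces_to_nf M \<tau>bar f g l" for g
    using assms(6) by (rule terminating_reduction_has_normal_form)
  have nf': "\<exists>l. reduces_to_nf M \<tau>' f g l" for g
    using nf_bar reduces_to_nf_mono[of M \<tau>bar f g _ \<tau>'] assms(4) by blast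
  have nf: "\<exists>l. reduces_to_nf M \<tau> f g l" for g
    using nf' reduces_to_nf_mono[of M \<tau>' f g _ \<tau>] sub by blast
  note basis_iff = marked_basis_iff_ideal_inter_normal_forms[OF assms(7) nf]

  have "confluent_red M \<tau> f" if "marked_basis M \<Lambda> f"
    unfolding confluent_red_def using nf marked_basis_unique_normal_form[OF that] by blast
  moreover
  let ?S = "\<lambda>\<sigma>. lspan (term_multiples M \<sigma> f)"
  let ?zero = "\<lambda>\<sigma>. \<forall>\<alpha>\<in>M. \<forall>\<gamma>. \<gamma> \<notin> \<sigma> \<alpha> \<longrightarrow> reduces_to_nf M \<sigma> f (pmonom 1 \<gamma> * f \<alpha>) 0"
  have "?S \<tau>bar = ?S \<tau> \<and> ?S \<tau>' = ?S \<tau> \<and>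
      (pideal (f ` M) = ?S \<tau>bar \<longleftrightarrow> ?zero \<tau>bar) \<and>
      (pideal (f ` M) = ?S \<tau>' \<longleftrightarrow> ?zero \<tau>') \<and>
      (pideal (f ` M) = ?S \<tau> \<longleftrightarrow> ?zero \<tau>) \<and>
      (marked_basis M \<Lambda> f \<longleftrightarrow> pideal (f ` M) = ?S \<tau>)"
    if confluent: "confluent_red M \<tau> f"
  proof -
    have direct: "p = 0" if "p \<in> ?S \<tau>" "Poly_Mapping.keys p \<subseteq> nform_terms M" for p
      using confluent monic that by (rule span_multiples_inter_normal_forms)
    have eq_bar: "?S \<tau>bar = ?S \<tau>"
      using nf_bar sub_bar direct by (rule span_multiples_eqI)
    have eq': "?S \<tau>' = ?S \<tau>"
      using nf' sub direct by (rule span_multiples_eqI)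
    have "pideal (f ` M) = ?S \<tau>" if "marked_basis M \<Lambda> f"
    proof -
      \<comment> \<open>the ideal is the span for the family of all terms, and it meets the normal forms trivially\<close>
      have "?S \<tau> = ?S (\<lambda>_. UNIV)"
        using that basis_iff
        by (intro span_multiples_eqI nf) (auto simp: ideal_eq_span_all_multiples)
      then show ?thesis by (simp add: ideal_eq_span_all_multiples)
    qed
    moreover have "marked_basis M \<Lambda> f" if "pideal (f ` M) = ?S \<tau>"
      using direct that basis_iff by auto
    moreover have "pideal (f ` M) = ?S \<tau>bar \<longleftrightarrow> ?zero \<tau>bar"
      using nf_bar direct
      by (intro ideal_eq_span_iff_multiples_reduce_to_zero) (auto simp: eq_bar)
    moreover have "pideal (f ` M) = ?S \<tau>' \<longleftrightarrow> ?zero \<tau>'"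
      using nf' direct
      by (intro ideal_eq_span_iff_multiples_reduce_to_zero) (auto simp: eq')
    moreover have "pideal (f ` M) = ?S \<tau> \<longleftrightarrow> ?zero \<tau>"
      using nf direct by (rule ideal_eq_span_iff_multiples_reduce_to_zero)
    ultimately show ?thesis using eq_bar eq' by blast
  qed
  ultimately show ?thesis
    unfolding Let_def by metis
qed

end
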